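(* For every integer $n \geq 1$, the orthogonal group $O(n)$ of real orthogonal $n \times n$ matrices is natural.
   Context: A group $(G,* )$ is called natural if there exists a metric $d$ on the underlying set $G$ such that (i) every right translation $R_g: x \mapsto x*g$, $g \in G$, is an isometry of $(G,d)$, and (ii) whenever $(G,\circ)$ is any group structure on the same set $G$ all of whose right translations are isometries of $(G,d)$, then $(G,\circ)$ is isomorphic to $(G,* )$ as an abstract group. The metric $d$ is not required to induce the usual topology of $O(n)$. *)

theory Defs
  imports "HOL-Analysis.Analysis" "HOL-Algebra.Group"
begin

definition metric_isometry :: "'a set \<Rightarrow> ('a \<Rightarrow> 'a \<Rightarrow> real) \<Rightarrow> ('a \<Rightarrow> 'a) \<Rightarrow> bool" where
  "metric_isometry M d f \<longleftrightarrow>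
     bij_betw f M M \<and> (\<forall>x\<in>M. \<forall>y\<in>M. d (f x) (f y) = d x y)"

definition right_translations_isometric :: "'a monoid \<Rightarrow> ('a \<Rightarrow> 'a \<Rightarrow> real) \<Rightarrow> bool" where
  "right_translations_isometric G d \<longleftrightarrow>
     (\<forall>g\<in>carrier G. metric_isometry (carrier G) d (\<lambda>x. x \<otimes>\<^bsub>G\<^esub> g))"

definition natural_group :: "'a monoid \<Rightarrow> bool" where
  "natural_group G \<longleftrightarrow>
     group G \<and>
     (\<exists>d. Metric_space (carrier G) d \<and>
          right_translations_isometric G d \<and>
          (\<forall>H :: 'a monoid.
             group H \<and> carrier H = carrier G \<and> right_translations_isometric H d
             \<longrightarrow> H \<cong> G))"

text \<open>The size is n = CARD('n). As index types are finite and nonempty, it ranges over all n with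
  n \<ge> 1.\<close>

definition orthogonal_group :: "(real ^ 'n ^ 'n) monoid" where
  "orthogonal_group = \<lparr>carrier = {Q. orthogonal_matrix Q}, mult = (**), one = mat 1\<rparr>"

end

theory Submission
  imports Defs "HOL-Algebra.Generated_Groups"
begin

text \<open>
  In a metric for which all right translations are isometries, the distance from \<open>x\<close> to \<open>y\<close> depends
  only on \<open>x y\<^sup>-\<^sup>1\<close>. Conversely, any function of \<open>x y\<^sup>-\<^sup>1\<close> that is unchanged under inversion and takes
  its values in \<open>[1, 2]\<close> off the diagonal is such a metric, because the triangle inequality holds for
  every choice of values in that interval. As a group of matrices has at most as many elements as
  there are real numbers, there is room to give every involution \<open>s\<close> a value of its own.

  An isometry \<open>f\<close> of this metric sees the distance between \<open>s x\<close> and \<open>x\<close> and recovers \<open>s\<close> from it,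
  so \<open>f (s x) = s f x\<close>. If the involutions generate the group, then \<open>f\<close> commutes with all left
  translations and is therefore a right translation. A second group structure on the same set whose
  right translations are isometries thus embeds into the right translations of the given group by
  sending \<open>h\<close> to \<open>1 \<circ> h\<close>, and the embedding is onto because \<open>1 \<circ> h\<close> takes every value
  (lemma \<open>natural_group_if_generated_by_involutions\<close>).

  The orthogonal group is generated by the reflections in hyperplanes, which are involutions; this is
  the theorem of Cartan and Dieudonne in its simplest form (lemma \<open>orthogonal_group_generated_by_involutions\<close>).
\<close>

section \<open>Groups generated by involutions\<close>

definition involutions :: "('a, 'b) monoid_scheme \<Rightarrow> 'a set" where
  "involutions G = {s \<in> carrier G. s \<otimes>\<^bsub>G\<^esub> s = \<one>\<^bsub>G\<^esub>}"

context group
begin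

lemma involution_inv: "s \<in> involutions G \<Longrightarrow> inv s = s"
  by (auto simp: involutions_def intro: inv_equality)

lemma inv_involution_iff:
  assumes "x \<in> carrier G"
  shows "inv x \<in> involutions G \<longleftrightarrow> x \<in> involutions G"
  using assms involution_inv inv_inv by metis

text \<open>A metric must be symmetric and nonnegative on the whole type, so pairs that leave the carrier
  get distance \<open>0\<close>. The elements that are not involutions all share the value \<open>1\<close>, which makes the
  symmetry immediate, and an involution is its own inverse.\<close>

definition involution_dist :: "('a \<Rightarrow> real) \<Rightarrow> 'a \<Rightarrow> 'a \<Rightarrow> real" where
  "involution_dist c x y =
     (if x = y \<or> x \<notin> carrier G \<or> y \<notin> carrier G then 0
      else if x \<otimes> inv y \<in> involutions G then c (x \<otimes> inv y) else 1)"

lemma involution_dist_commute: "involution_dist c x y = involution_dist c y x"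
proof (cases "x \<in> carrier G \<and> y \<in> carrier G")
  case True
  then have *: "inv (x \<otimes> inv y) = y \<otimes> inv x"
    by (simp add: inv_mult_group)
  show ?thesis
  proof (cases "x \<otimes> inv y \<in> involutions G")
    case True
    then have "y \<otimes> inv x = x \<otimes> inv y"
      using * involution_inv by simp
    then show ?thesis
      by (auto simp: involution_dist_def)
  next
    case False
    then have "y \<otimes> inv x \<notin> involutions G"
      using * inv_involution_iff[of "x \<otimes> inv y"] \<open>x \<in> carrier G \<and> y \<in> carrier G\<close> by simp
    then show ?thesis
      using False by (auto simp: involution_dist_def)
  qed
qed (auto simp: involution_dist_def)

lemma Metric_space_involution_dist:
  assumes c: "\<And>x. x \<in> carrier G \<Longrightarrow> 1 < c x \<and> c x < 2"
  shows "Metric_space (carrier G) (involution_dist c)"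
proof -
  have bounds: "1 \<le> involution_dist c x y \<and> involution_dist c x y \<le> 2"
    if "x \<in> carrier G" "y \<in> carrier G" "x \<noteq> y" for x y
    using c[of "x \<otimes> inv y"] that by (auto simp: involution_dist_def)
  have refl: "involution_dist c x x = 0" for x
    by (simp add: involution_dist_def)
  show ?thesis
  proof
    fix x y
    show "0 \<le> involution_dist c x y"
      using bounds[of x y] by (cases "x = y \<or> x \<notin> carrier G \<or> y \<notin> carrier G")
        (auto simp: involution_dist_def)
    show "involution_dist c x y = involution_dist c y x"
      by (rule involution_dist_commute)
    assume xy: "x \<in> carrier G" "y \<in> carrier G"
    show "involution_dist c x y = 0 \<longleftrightarrow> x = y"
      using bounds[OF xy] refl by fastforce
    fix z assume z: "z \<in> carrier G"
    consider "x = z" | "x = y" | "y = z" | "x \<noteq> z" "x \<noteq> y" "y \<noteq> z"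
      by blast
    then show "involution_dist c x z \<le> involution_dist c x y + involution_dist c y z"
    proof cases
      case 1
      then show ?thesis
        using bounds[of z y] bounds[of y z] refl xy z by (cases "y = z") force+
    next
      case 4
      then show ?thesis
        using bounds[of x z] bounds[of x y] bounds[of y z] xy z by linarith
    qed (simp_all add: refl)
  qed
qed

lemma mult_inv_right_translate:
  assumes "x \<in> carrier G" "y \<in> carrier G" "g \<in> carrier G"
  shows "(x \<otimes> g) \<otimes> inv (y \<otimes> g) = x \<otimes> inv y"
  using assms by (metis inv_closed inv_mult_group inv_solve_right m_assoc m_closed)

lemma bij_betw_right_translation:
  assumes "g \<in> carrier G"
  shows "bij_betw (\<lambda>x. x \<otimes> g) (carrier G) (carrier G)"
  by (rule bij_betw_byWitness[where f' = "\<lambda>x. x \<otimes> inv g"]) (use assms in \<open>auto simp: m_assoc\<close>)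

lemma bij_betw_left_translation:
  assumes "g \<in> carrier G"
  shows "bij_betw (\<lambda>x. g \<otimes> x) (carrier G) (carrier G)"
  by (rule bij_betw_byWitness[where f' = "\<lambda>x. inv g \<otimes> x"])
    (use assms in \<open>auto simp: m_assoc[symmetric]\<close>)

lemma right_translations_isometric_involution_dist:
  "metric_isometry (carrier G) (involution_dist c) (\<lambda>x. x \<otimes> g)" if "g \<in> carrier G"
  using that bij_betw_right_translation mult_inv_right_translate
  by (simp add: metric_isometry_def involution_dist_def)

text \<open>If \<open>s \<noteq> \<one>\<close>, the distance from \<open>s x\<close> to \<open>x\<close> is \<open>c s\<close>, and as it exceeds \<open>1\<close> only the involution
  \<open>s\<close> itself can produce it.\<close>

lemma isometry_commutes_with_involution:
  assumes c: "\<And>x. x \<in> carrier G \<Longrightarrow> 1 < c x" and inj: "inj_on c (carrier G)"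
    and f: "metric_isometry (carrier G) (involution_dist c) f"
    and s: "s \<in> involutions G" and x: "x \<in> carrier G"
  shows "f (s \<otimes> x) = s \<otimes> f x"
proof (cases "s = \<one>")
  case True
  moreover have "f x \<in> carrier G"
    using f x by (auto simp: metric_isometry_def bij_betw_def)
  ultimately show ?thesis
    using x by simp
next
  case False
  have sG: "s \<in> carrier G"
    using s by (simp add: involutions_def)
  have fG: "f y \<in> carrier G" if "y \<in> carrier G" for y
    using f that by (auto simp: metric_isometry_def bij_betw_def)
  have quot: "s \<otimes> x \<otimes> inv x = s"
    using sG x by (simp add: m_assoc)
  then have "s \<otimes> x \<noteq> x"
    using False x by (metis r_inv)
  then have "involution_dist c (s \<otimes> x) x = c s"
    using quot s sG x by (simp add: involution_dist_def)
  then have d: "involution_dist c (f (s \<otimes> x)) (f x) = c s"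
    using f sG x by (simp add: metric_isometry_def)
  define t where "t = f (s \<otimes> x) \<otimes> inv (f x)"
  have tG: "t \<in> carrier G"
    using fG sG x by (simp add: t_def)
  have "c t = c s"
    using d c[OF sG] by (auto simp: involution_dist_def t_def split: if_splits)
  then have "t = s"
    using inj tG sG by (auto dest: inj_onD)
  then show ?thesis
    using fG sG x by (metis inv_solve_right m_closed t_def)
qed

lemma isometry_commutes_with_left_translations:
  assumes gen: "generate G (involutions G) = carrier G"
    and c: "\<And>x. x \<in> carrier G \<Longrightarrow> 1 < c x" and inj: "inj_on c (carrier G)"
    and f: "metric_isometry (carrier G) (involution_dist c) f"
    and g: "g \<in> carrier G" and x: "x \<in> carrier G"
  shows "f (g \<otimes> x) = g \<otimes> f x"
proof -
  have fG: "f y \<in> carrier G" if "y \<in> carrier G" for y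
    using f that by (auto simp: metric_isometry_def bij_betw_def)
  have "g \<in> generate G (involutions G)"
    using gen g by simp
  then show ?thesis
    using x
  proof (induction arbitrary: x rule: generate.induct)
    case one
    then show ?case
      using fG by simp
  next
    case (incl s)
    then show ?case
      using isometry_commutes_with_involution[OF c inj f] by blast
  next
    case (inv s)
    then show ?case
      using isometry_commutes_with_involution[OF c inj f] involution_inv by simp
  next
    case (eng g h)
    then show ?case
      using fG gen by (simp add: m_assoc)
  qed
qed

end

text \<open>The second group \<open>H\<close> may have a different neutral element, so the isomorphism is not the
  identity map in general. An isometry that commutes with all left translations of \<open>G\<close> is determined
  by its value at \<open>\<one>\<close>, which is why \<open>h\<close> is sent to \<open>\<one> \<circ> h\<close>.\<close>

theorem natural_group_if_generated_by_involutions: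
  fixes G :: "'a monoid" (structure)
  assumes "group G" and gen: "generate G (involutions G) = carrier G"
    and card: "carrier G \<lesssim> (UNIV :: real set)"
  shows "natural_group G"
proof -
  interpret group G by fact
  have "carrier G \<lesssim> {1<..<2::real}"
    using card open_interval_eqpoll_reals[of 1 2]
    by (meson eqpoll_imp_lepoll eqpoll_sym lepoll_trans one_less_numeral_iff semiring_norm(76))
  then obtain c :: "'a \<Rightarrow> real"
    where inj: "inj_on c (carrier G)" and range: "c ` carrier G \<subseteq> {1<..<2}"
    by (auto simp: lepoll_def)
  have c: "1 < c x \<and> c x < 2" if "x \<in> carrier G" for x
    using range that by auto
  let ?d = "involution_dist c"
  have "H \<cong> G"
    if H: "group H" "carrier H = carrier G" "right_translations_isometric H ?d" for H :: "'a monoid"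
  proof -
    interpret H: group H by (fact H(1))
    have translate: "x \<otimes>\<^bsub>H\<^esub> h = x \<otimes> (\<one> \<otimes>\<^bsub>H\<^esub> h)" if "x \<in> carrier G" "h \<in> carrier G" for x h
    proof -
      have "metric_isometry (carrier G) ?d (\<lambda>x. x \<otimes>\<^bsub>H\<^esub> h)"
        using H that by (simp add: right_translations_isometric_def)
      from isometry_commutes_with_left_translations[OF gen _ inj this \<open>x \<in> carrier G\<close> one_closed]
      show ?thesis
        using c that by simp
    qed
    have "(\<lambda>h. \<one> \<otimes>\<^bsub>H\<^esub> h) \<in> iso H G"
    proof (rule isoI)
      show "bij_betw (\<lambda>h. \<one> \<otimes>\<^bsub>H\<^esub> h) (carrier H) (carrier G)"
        using H.bij_betw_left_translation[of \<one>] H(2) by simp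
      show "(\<lambda>h. \<one> \<otimes>\<^bsub>H\<^esub> h) \<in> hom H G"
      proof (rule homI)
        fix h k assume hk: "h \<in> carrier H" "k \<in> carrier H"
        show "\<one> \<otimes>\<^bsub>H\<^esub> h \<in> carrier G"
          using hk H(2) H.m_closed one_closed by metis
        have "\<one> \<otimes>\<^bsub>H\<^esub> (h \<otimes>\<^bsub>H\<^esub> k) = (\<one> \<otimes>\<^bsub>H\<^esub> h) \<otimes>\<^bsub>H\<^esub> k"
          using hk H(2) H.m_assoc one_closed by metis
        also have "\<dots> = (\<one> \<otimes>\<^bsub>H\<^esub> h) \<otimes> (\<one> \<otimes>\<^bsub>H\<^esub> k)"
          using hk H(2) H.m_closed one_closed translate by metis
        finally show "\<one> \<otimes>\<^bsub>H\<^esub> (h \<otimes>\<^bsub>H\<^esub> k) = (\<one> \<otimes>\<^bsub>H\<^esub> h) \<otimes> (\<one> \<otimes>\<^bsub>H\<^esub> k)" .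
      qed
    qed
    then show ?thesis
      by (rule is_isoI)
  qed
  moreover have "right_translations_isometric G ?d"
    using right_translations_isometric_involution_dist by (simp add: right_translations_isometric_def)
  moreover have "Metric_space (carrier G) ?d"
    by (rule Metric_space_involution_dist) (rule c)
  ultimately show ?thesis
    using \<open>group G\<close> by (auto simp: natural_group_def)
qed

section \<open>The number of elements of a second countable space\<close>

text \<open>A point of a Hausdorff space is determined by the members of a countable base that contain
  it.\<close>

lemma second_countable_lepoll_reals:
  "(UNIV :: 'a::{second_countable_topology, t2_space} set) \<lesssim> (UNIV :: real set)"
proof -
  obtain B :: "'a set set" where "countable B" and B: "topological_basis B"
    using ex_countable_basis by blast
  have "inj (\<lambda>x. {n. \<exists>b\<in>B. x \<in> b \<and> to_nat_on B b = n})"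
  proof (rule injI, rule ccontr)
    fix x y :: 'a
    assume eq: "{n. \<exists>b\<in>B. x \<in> b \<and> to_nat_on B b = n} = {n. \<exists>b\<in>B. y \<in> b \<and> to_nat_on B b = n}"
      and "x \<noteq> y"
    then obtain U where "open U" "x \<in> U" "y \<notin> U"
      using t1_space by blast
    then obtain b where b: "b \<in> B" "x \<in> b" "y \<notin> b"
      using topological_basisE[OF B] by (metis subsetD)
    then have "to_nat_on B b \<in> {n. \<exists>b\<in>B. y \<in> b \<and> to_nat_on B b = n}"
      unfolding eq[symmetric] by blast
    then obtain b' where "b' \<in> B" "y \<in> b'" "to_nat_on B b' = to_nat_on B b"
      by blast
    then show False
      using b \<open>countable B\<close> by simp
  qed
  then have "(UNIV :: 'a set) \<lesssim> (UNIV :: nat set set)"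
    by (auto simp: lepoll_def)
  then show ?thesis
    using eqpoll_imp_lepoll lepoll_trans nat_sets_eqpoll_reals by blast
qed

section \<open>Reflections generate the orthogonal group\<close>

text \<open>Division by zero makes this the identity for \<open>a = 0\<close>, so every vector yields an orthogonal
  transformation.\<close>

definition hyperplane_reflection :: "'a::real_inner \<Rightarrow> 'a \<Rightarrow> 'a" where
  "hyperplane_reflection a x = x - (2 * (a \<bullet> x) / (a \<bullet> a)) *\<^sub>R a"

lemma linear_hyperplane_reflection: "linear (hyperplane_reflection a)"
  by (rule linearI) (auto simp: hyperplane_reflection_def algebra_simps add_divide_distrib)

lemma hyperplane_reflection_involutive:
  "hyperplane_reflection a (hyperplane_reflection a x) = x"
  by (cases "a = 0") (simp_all add: hyperplane_reflection_def inner_diff_right flip: scaleR_add_left)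

lemma orthogonal_transformation_hyperplane_reflection:
  "orthogonal_transformation (hyperplane_reflection a)"
proof -
  have "hyperplane_reflection a v \<bullet> hyperplane_reflection a w = v \<bullet> w" for v w
    by (cases "a = 0")
      (simp_all add: hyperplane_reflection_def inner_diff_left inner_diff_right inner_commute)
  then show ?thesis
    using linear_hyperplane_reflection by (simp add: orthogonal_transformation_def)
qed

lemma hyperplane_reflection_fixes:
  "a \<bullet> x = 0 \<Longrightarrow> hyperplane_reflection a x = x"
  by (simp add: hyperplane_reflection_def)

text \<open>Two vectors of equal length are exchanged by the reflection in the hyperplane that is
  equidistant from them.\<close>

lemma hyperplane_reflection_exchanges:
  assumes "norm w = norm v"
  shows "hyperplane_reflection (v - w) w = v"
proof (cases "v = w")
  case False
  have "2 * ((v - w) \<bullet> w) = - ((v - w) \<bullet> (v - w))"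
    using assms by (simp add: norm_eq inner_diff_left inner_diff_right inner_commute)
  moreover have "(v - w) \<bullet> (v - w) \<noteq> 0"
    using False by simp
  ultimately have "2 * ((v - w) \<bullet> w) / ((v - w) \<bullet> (v - w)) = - 1"
    by (subst divide_eq_minus_1_iff) blast
  then show ?thesis
    by (simp add: hyperplane_reflection_def)
qed (simp add: hyperplane_reflection_def)

lemma group_orthogonal_group: "group (orthogonal_group :: (real ^ 'n ^ 'n) monoid)"
proof (rule groupI)
  fix Q :: "real ^ 'n ^ 'n"
  assume "Q \<in> carrier orthogonal_group"
  then show "\<exists>P\<in>carrier orthogonal_group. P \<otimes>\<^bsub>orthogonal_group\<^esub> Q = \<one>\<^bsub>orthogonal_group\<^esub>"
    by (intro bexI[of _ "transpose Q"]) (auto simp: orthogonal_group_def orthogonal_matrix_def)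
qed (auto simp: orthogonal_group_def orthogonal_matrix_mul orthogonal_matrix_id matrix_mul_assoc)

lemma matrix_hyperplane_reflection_involution:
  "matrix (hyperplane_reflection a) \<in> involutions (orthogonal_group :: (real ^ 'n ^ 'n) monoid)"
proof -
  let ?R = "matrix (hyperplane_reflection a)"
  have "orthogonal_matrix ?R"
    using orthogonal_transformation_hyperplane_reflection orthogonal_transformation_matrix by blast
  moreover have "?R ** ?R = mat 1"
    by (simp add: matrix_eq matrix_works linear_hyperplane_reflection hyperplane_reflection_involutive
        flip: matrix_vector_mul_assoc)
  ultimately show ?thesis
    by (simp add: involutions_def orthogonal_group_def)
qed

text \<open>If \<open>Q\<close> moves \<open>v\<close>, then the reflection along \<open>v - Q v\<close> takes \<open>Q v\<close> back to \<open>v\<close>. It fixes every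
  vector \<open>x\<close> that \<open>Q\<close> fixes, because \<open>x \<bullet> Q v = Q x \<bullet> Q v = x \<bullet> v\<close>. Hence the product of this
  reflection with \<open>Q\<close> has a fixed space of larger dimension.\<close>

lemma orthogonal_matrix_in_generate_involutions:
  fixes Q :: "real ^ 'n ^ 'n"
  assumes "orthogonal_matrix Q"
  shows "Q \<in> generate orthogonal_group (involutions orthogonal_group)"
  using assms
proof (induction "CARD('n) - dim {x. Q *v x = x}" arbitrary: Q rule: less_induct)
  case less
  show ?case
  proof (cases "\<forall>v. Q *v v = v")
    case True
    then have "Q = mat 1"
      by (simp add: matrix_eq)
    then show ?thesis
      using generate.one[of "orthogonal_group :: (real ^ 'n ^ 'n) monoid"]
      by (simp add: orthogonal_group_def)
  next
    case False
    then obtain v where v: "Q *v v \<noteq> v"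
      by blast
    have Q: "orthogonal_transformation ((*v) Q)"
      using less.prems by (simp add: orthogonal_transformation_matrix)
    let ?R = "matrix (hyperplane_reflection (v - Q *v v))"
    let ?P = "?R ** Q"
    have R: "?R \<in> involutions orthogonal_group"
      by (rule matrix_hyperplane_reflection_involution)
    have P_apply: "?P *v x = hyperplane_reflection (v - Q *v v) (Q *v x)" for x
      by (simp add: matrix_works linear_hyperplane_reflection flip: matrix_vector_mul_assoc)
    have "orthogonal_matrix ?P"
      using R less.prems by (simp add: involutions_def orthogonal_group_def orthogonal_matrix_mul)
    have Pv: "?P *v v = v"
      using Q by (simp add: P_apply hyperplane_reflection_exchanges orthogonal_transformation)
    have "?P *v x = x" if x: "Q *v x = x" for x
    proof -
      have "(Q *v v) \<bullet> x = v \<bullet> x"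
        using Q x by (metis orthogonal_transformation_def)
      then show ?thesis
        by (simp add: P_apply x hyperplane_reflection_fixes inner_diff_left)
    qed
    then have "{x. Q *v x = x} \<subset> {x. ?P *v x = x}"
      using v Pv by blast
    moreover have fixed: "span {x. A *v x = x} = {x. A *v x = x}" for A :: "real ^ 'n ^ 'n"
      by (simp add: subspace_def matrix_vector_right_distrib matrix_vector_mult_scaleR)
    ultimately have "dim {x. Q *v x = x} < dim {x. ?P *v x = x}"
      by (intro dim_psubset) (simp only: fixed)
    moreover have "dim {x. ?P *v x = x} \<le> CARD('n)"
      by (rule dim_subset_UNIV_cart)
    ultimately have "?P \<in> generate orthogonal_group (involutions orthogonal_group)"
      using less.hyps \<open>orthogonal_matrix ?P\<close> by simp
    moreover have "?R ** ?P = Q"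
      using R by (simp add: matrix_mul_assoc involutions_def orthogonal_group_def)
    ultimately show ?thesis
      using generate.eng[OF generate.incl[OF R]] by (metis monoid.simps(1) orthogonal_group_def)
  qed
qed

lemma orthogonal_group_generated_by_involutions:
  "generate orthogonal_group (involutions orthogonal_group)
     = carrier (orthogonal_group :: (real ^ 'n ^ 'n) monoid)"
proof
  show "generate orthogonal_group (involutions orthogonal_group)
      \<subseteq> carrier (orthogonal_group :: (real ^ 'n ^ 'n) monoid)"
    by (rule group.generate_incl[OF group_orthogonal_group]) (auto simp: involutions_def)
qed (use orthogonal_matrix_in_generate_involutions in \<open>auto simp: orthogonal_group_def\<close>)

theorem theorem10:
  shows "natural_group (orthogonal_group :: (real ^ 'n::finite ^ 'n) monoid)"
  using group_orthogonal_group orthogonal_group_generated_by_involutions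
    lepoll_trans[OF subset_imp_lepoll[OF subset_UNIV] second_countable_lepoll_reals]
  by (rule natural_group_if_generated_by_involutions)

end
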